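(* There exist constants $\epsilon>0$ and $c>0$ such that for every positive integer $d$ there exist a positive integer $n$, an integer $k\geq \exp(c\sqrt{d})$, and a monotone function $f:\{0,1\}^n\to\{0,1\}$ computed by a decision tree of depth at most $d$, such that for every $k$-junta $g:\{0,1\}^n\to\{0,1\}$, $f$ and $g$ disagree on at least an $\epsilon$-fraction of the inputs in $\{0,1\}^n$.
   Context: A function $f:\{0,1\}^n\to\{0,1\}$ is monotone if $f(x)\le f(x')$ whenever $x\le x'$ coordinatewise. A $k$-junta is a function $g:\{0,1\}^n\to\{0,1\}$ that depends on at most $k$ of its coordinates. A depth-$d$ decision tree is a rooted binary tree whose internal nodes query an input coordinate and whose leaves are labeled by output values, with every root-to-leaf path of length at most $d$. The fraction of disagreement is taken with respect to the uniform distribution on $\{0,1\}^n$.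
   Formalization: The claim is proved for every integer d ≥ 3 instead of every positive d; for d = 1, 2 it is false, since k ≥ exp(c√d) > 1 forces k ≥ 2, while every monotone function with a decision tree of depth at most 2 is itself a 2-junta. *)

theory Defs
  imports Complex_Main "HOL-Library.FuncSet"
begin

text \<open>
  Points of \<open>{0,1}\<^sup>n\<close> are extensional functions on \<open>{..<n}\<close>. Off \<open>{..<n}\<close> they all agree, so the
  library order on functions restricts to the coordinatewise order on the cube, and monotonicity
  of \<open>f\<close> is \<open>mono_on (cube n) f\<close>. A Boolean function on the cube is a total function on
  \<open>nat \<Rightarrow> bool\<close> of which only the values on \<open>cube n\<close> are ever used.
\<close>

definition cube :: "nat \<Rightarrow> (nat \<Rightarrow> bool) set" where
  "cube n = {..<n} \<rightarrow>\<^sub>E UNIV"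

definition junta :: "nat \<Rightarrow> nat \<Rightarrow> ((nat \<Rightarrow> bool) \<Rightarrow> bool) \<Rightarrow> bool" where
  "junta n k g \<longleftrightarrow> (\<exists>J \<subseteq> {..<n}. card J \<le> k \<and>
     (\<forall>x \<in> cube n. \<forall>y \<in> cube n. (\<forall>i \<in> J. x i = y i) \<longrightarrow> g x = g y))"

text \<open>In \<open>Query i l r\<close> the subtree \<open>l\<close> is taken when coordinate \<open>i\<close> is 0, and \<open>r\<close> when it is 1.\<close>

datatype (coords: 'i) dtree = Leaf bool | Query 'i "'i dtree" "'i dtree"

primrec depth :: "'i dtree \<Rightarrow> nat" where
  "depth (Leaf b) = 0"
| "depth (Query i l r) = Suc (max (depth l) (depth r))"

primrec eval_dtree :: "'i dtree \<Rightarrow> ('i \<Rightarrow> bool) \<Rightarrow> bool" where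
  "eval_dtree (Leaf b) x = b"
| "eval_dtree (Query i l r) x = (if x i then eval_dtree r x else eval_dtree l x)"

definition dtree_computable :: "nat \<Rightarrow> nat \<Rightarrow> ((nat \<Rightarrow> bool) \<Rightarrow> bool) \<Rightarrow> bool" where
  "dtree_computable n d f \<longleftrightarrow> (\<exists>t. coords t \<subseteq> {..<n} \<and> depth t \<le> d \<and>
     (\<forall>x \<in> cube n. eval_dtree t x = f x))"

definition disagreement ::
    "nat \<Rightarrow> ((nat \<Rightarrow> bool) \<Rightarrow> bool) \<Rightarrow> ((nat \<Rightarrow> bool) \<Rightarrow> bool) \<Rightarrow> real" where
  "disagreement n f g = real (card {x \<in> cube n. f x \<noteq> g x}) / real (card (cube n))"

text \<open>
  A lower bound \<open>k \<ge> exp (c * sqrt d)\<close> with \<open>c > 0\<close> forces \<open>k \<ge> 2\<close>, while every monotone function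
  with a decision tree of depth at most 2 is itself a 2-junta. Hence inapproximability by
  \<open>k\<close>-juntas is impossible for \<open>d \<le> 2\<close>, and only \<open>d \<ge> 3\<close> can be meant.
\<close>

lemma junta_mono: "junta n k g \<Longrightarrow> k \<le> k' \<Longrightarrow> junta n k' g"
  unfolding junta_def by (blast intro: le_trans)

lemma junta_2_if_depth_le_2:
  assumes mono: "mono_on (cube n) f" and dt: "dtree_computable n d f" and d: "d \<le> 2"
  shows "junta n 2 f"
proof -
  obtain t where tn: "coords t \<subseteq> {..<n}" and td: "depth t \<le> 2"
    and tf: "\<And>x. x \<in> cube n \<Longrightarrow> f x = eval_dtree t x"
    using dt d unfolding dtree_computable_def by (metis le_trans)
  have I: "junta n 2 f" if "J \<subseteq> {..<n}" "card J \<le> 2"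
      "\<And>x y. \<forall>i\<in>J. x i = y i \<Longrightarrow> eval_dtree t x = eval_dtree t y" for J
    unfolding junta_def
  proof (intro exI[of _ J] conjI ballI impI)
    fix x y assume "x \<in> cube n" "y \<in> cube n" "\<forall>i\<in>J. x i = y i"
    with that(3)[of x y] tf show "f x = f y" by simp
  qed (use that in auto)
  have ev: "eval_dtree t x = eval_dtree t y" if "\<forall>i\<in>coords t. x i = y i" for x y
    using that by (induction t) auto
  have small: "junta n 2 f" if "card (coords t) \<le> 2"
    using I[OF tn that ev] .
  have c2: "card {i, j} \<le> 2" for i j :: nat
    by (simp add: card_insert_if)
  have lf: "\<exists>b. s = Leaf b" if "depth s = 0" for s :: "nat dtree"
    using that by (cases s) auto
  have d1: "(\<exists>b. s = Leaf b) \<or> (\<exists>j a b. s = Query j (Leaf a) (Leaf b))"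
    if "depth s \<le> 1" for s :: "nat dtree"
  proof (cases s)
    case (Query j l r)
    then have "depth l = 0" "depth r = 0" using that by auto
    then obtain a b where "l = Leaf a" "r = Leaf b" using lf by meson
    then show ?thesis using Query by simp
  qed auto
  show ?thesis
  proof (cases t)
    case (Leaf b)
    then show ?thesis by (intro small) simp
  next
    case t: (Query i l r)
    have "depth l \<le> 1" "depth r \<le> 1" using td t by auto
    note l = d1[OF this(1)] and r = d1[OF this(2)]
    show ?thesis
    proof (cases "(\<exists>b. l = Leaf b) \<or> (\<exists>b. r = Leaf b)")
      case True
      then show ?thesis using l r by (intro small) (auto simp: t card_insert_if)
    next
      case False
      then obtain j a b m c e where
        lr: "l = Query j (Leaf a) (Leaf b)" "r = Query m (Leaf c) (Leaf e)"
        using l r by blast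
      have lt: "i < n" "j < n" "m < n" using tn t lr by auto
      consider "i = j \<or> i = m \<or> j = m" | "a = b" | "c = e"
        | "i \<noteq> j" "i \<noteq> m" "j \<noteq> m" "a \<noteq> b" "c \<noteq> e" by blast
      then show ?thesis
      proof cases
        case 1
        then show ?thesis by (intro small) (auto simp: t lr card_insert_if)
      next
        case 2
        then show ?thesis using lt c2 by (intro I[of "{i, m}"]) (auto simp: t lr)
      next
        case 3
        then show ?thesis using lt c2 by (intro I[of "{i, j}"]) (auto simp: t lr)
      next
        case 4
        define x where "x = (\<lambda>p\<in>{..<n}. if p = j then b else p = m \<and> \<not> e)"
        define y where "y = (\<lambda>p\<in>{..<n}. p = i \<or> x p)"
        have cx: "x \<in> cube n" "y \<in> cube n"
          unfolding cube_def x_def y_def by auto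
        have le: "x \<le> y"
          unfolding le_fun_def x_def y_def by auto
        have "f x \<le> f y" using mono cx le by (auto simp: mono_on_def)
        moreover have "f x" "\<not> f y"
          using cx 4 lt by (auto simp: tf t lr x_def y_def)
        ultimately show ?thesis by simp
      qed
    qed
  qed
qed

lemma depth_le_2_excluded:
  assumes "\<epsilon> > 0" "c > 0" "0 < d" "d \<le> 2" "real k \<ge> exp (c * sqrt (real d))"
    and "mono_on (cube n) f" "dtree_computable n d f"
  shows "\<exists>g. junta n k g \<and> disagreement n f g < \<epsilon>"
proof (intro exI conjI)
  have "exp (c * sqrt (real d)) > 1" using assms by simp
  then have k: "2 \<le> k" using assms(5) by linarith
  show "junta n k f"
    using junta_2_if_depth_le_2[OF assms(6,7,4)] k by (rule junta_mono)
  show "disagreement n f f < \<epsilon>" using assms(1) by (simp add: disagreement_def)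
qed

end

theory Submission
  imports Defs "HOL-Library.Discrete_Functions"
begin

text \<open>
  Let the first \<open>w\<^sup>2\<close> coordinates be \<open>w\<close> blocks of length \<open>w\<close>, and let \<open>A i\<close> (\<open>i < N\<close>) be terms, each
  the conjunction of one coordinate per block. Let \<open>f\<close> be 0 if no term is satisfied, 1 if at least
  two are, and the value of a private coordinate \<open>y\<^sub>i\<close> if \<open>A i\<close> is the only satisfied term. This is
  monotone and has a decision tree of depth \<open>w\<^sup>2 + 1\<close>. A term is the only satisfied one with
  probability at least \<open>2\<^sup>-\<^sup>w\<close> minus the sum of \<open>4\<^sup>-\<^sup>w 2\<^bsup>card (A i \<inter> A i')\<^esup>\<close> over \<open>i' \<noteq> i\<close>. For a random
  term the mean of \<open>2\<^bsup>card (A i \<inter> A i')\<^esup>\<close> is \<open>(1 + 1/w)\<^sup>w < 3\<close>, so the terms can be chosen greedily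
  such that for \<open>N = 2\<^sup>w / 8\<close> exactly one term is satisfied with constant probability, spread
  evenly over \<open>i\<close>. A junta on \<open>N / 2\<close> coordinates ignores half of the \<open>y\<^sub>i\<close>, and is wrong on half of the
  points where one of these decides. For \<open>d \<le> 25\<close> the bound on \<open>k\<close> only asks for \<open>k = 2\<close>, and the majority
  of three coordinates suffices.
\<close>

section \<open>Cube counts and decision trees\<close>

lemma card_cube: "card (cube n) = 2 ^ n"
  by (simp add: cube_def card_PiE card_UNIV_bool)

lemma finite_cube [simp]: "finite (cube n)"
  by (simp add: cube_def finite_PiE)

lemma fun_upd_in_cube: "x \<in> cube n \<Longrightarrow> i < n \<Longrightarrow> x(i := b) \<in> cube n"
  by (auto simp: cube_def PiE_iff extensional_def)

lemma card_cube_all_true: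
  assumes "A \<subseteq> {..<n}"
  shows "real (card {x \<in> cube n. \<forall>i\<in>A. x i}) = 2 ^ n / 2 ^ card A"
proof -
  have fin: "finite A" using assms finite_subset by blast
  have "{x \<in> cube n. \<forall>i\<in>A. x i} = (\<Pi>\<^sub>E i\<in>{..<n}. if i \<in> A then {True} else UNIV)"
    using assms unfolding cube_def PiE_iff set_eq_iff by (force split: if_split_asm)
  then have "card {x \<in> cube n. \<forall>i\<in>A. x i} = (\<Prod>i<n. if i \<in> A then 1 else 2)"
    by (auto simp: card_PiE card_UNIV_bool intro!: prod.cong)
  also have "\<dots> = 2 ^ (card ({..<n} - A))"
    by (simp add: prod.If_cases Diff_eq)
  finally have "card {x \<in> cube n. \<forall>i\<in>A. x i} = 2 ^ (n - card A)"
    using assms fin by (simp add: card_Diff_subset)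
  moreover have "card A \<le> n" using card_mono[OF _ assms] by simp
  then have "(2::real) ^ (n - card A) = 2 ^ n / 2 ^ card A" by (simp add: power_diff)
  ultimately show ?thesis by (simp only: of_nat_power of_nat_numeral)
qed

text \<open>A complete tree on the first \<open>m\<close> coordinates is put in front of the trees
  \<open>G z\<close>. In the induction the root reads the last prefix coordinate, and each branch
  applies the hypothesis to \<open>G\<close> with that coordinate fixed, hence the generalisation
  over \<open>G\<close>.\<close>

lemma exists_dtree_prefix:
  assumes "m \<le> n" and "\<And>z. coords (G z) \<subseteq> {..<n}" and "\<And>z. depth (G z) \<le> D"
  shows "\<exists>t. coords t \<subseteq> {..<n} \<and> depth t \<le> m + D \<and>
    (\<forall>x. eval_dtree t x = eval_dtree (G (\<lambda>i. i < m \<and> x i)) x)"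
  using assms
proof (induction m arbitrary: G)
  case 0
  then show ?case by (intro exI[of _ "G (\<lambda>_. False)"]) auto
next
  case (Suc m)
  have "\<exists>t. coords t \<subseteq> {..<n} \<and> depth t \<le> m + D \<and>
    (\<forall>x. eval_dtree t x = eval_dtree (G ((\<lambda>i. i < m \<and> x i)(m := b))) x)" for b
    using Suc.IH[of "\<lambda>z. G (z(m := b))"] Suc.prems by simp
  then obtain t where t: "\<And>b. coords (t b) \<subseteq> {..<n}" "\<And>b. depth (t b) \<le> m + D"
    "\<And>b x. eval_dtree (t b) x = eval_dtree (G ((\<lambda>i. i < m \<and> x i)(m := b))) x"
    by metis
  have "(\<lambda>i. i < m \<and> x i)(m := x m) = (\<lambda>i. i < Suc m \<and> x i)" for x :: "nat \<Rightarrow> bool"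
    by (auto simp: fun_eq_iff less_Suc_eq)
  then have "eval_dtree (t (x m)) x = eval_dtree (G (\<lambda>i. i < Suc m \<and> x i)) x" for x
    by (simp add: t(3))
  then show ?case
    using t(1,2) Suc.prems(1)
    by (intro exI[of _ "Query m (t False) (t True)"]) (auto split: if_splits, (metis (full_types))+)
qed

section \<open>Small depth: the majority of three coordinates\<close>

text \<open>Disagreement is a multiple of \<open>1 / 2 ^ n\<close>, so a smaller value can only be
  0.\<close>

lemma junta_if_disagreement_less:
  assumes "junta n k g" "disagreement n f g < 1 / 2 ^ n"
  shows "junta n k f"
proof -
  have "real (card {x \<in> cube n. f x \<noteq> g x}) < 1"
    using assms(2) by (simp add: disagreement_def card_cube divide_less_cancel)
  then have "\<forall>x\<in>cube n. f x = g x" by simp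
  then show ?thesis using assms(1) by (simp add: junta_def)
qed

lemma exists_mono_depth_3_not_2_junta:
  "\<exists>f. mono_on (cube 3) f \<and> dtree_computable 3 3 f \<and> \<not> junta 3 2 f"
proof -
  define f :: "(nat \<Rightarrow> bool) \<Rightarrow> bool" where
    "f = (\<lambda>x. x 0 \<and> x 1 \<or> x 0 \<and> x 2 \<or> x 1 \<and> x 2)"
  have "mono_on (cube 3) f" by (auto simp: mono_on_def f_def le_fun_def)
  moreover have "dtree_computable 3 3 f"
  proof -
    obtain t where "coords t \<subseteq> {..<3}" "depth t \<le> 3" and t: "\<And>x. eval_dtree t x = f (\<lambda>i. i < 3 \<and> x i)"
      using exists_dtree_prefix[of 3 3 "\<lambda>z. Leaf (f z)" 0] by auto
    moreover have "f (\<lambda>i. i < 3 \<and> x i) = f x" for x by (simp add: f_def)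
    ultimately show ?thesis unfolding dtree_computable_def by (intro exI[of _ t]) simp
  qed
  moreover have "\<not> junta 3 2 f"
  proof
    assume "junta 3 2 f"
    then obtain J where J: "J \<subseteq> {..<3}" "card J \<le> 2"
      "\<forall>x\<in>cube 3. \<forall>y\<in>cube 3. (\<forall>i\<in>J. x i = y i) \<longrightarrow> f x = f y"
      unfolding junta_def by blast
    have "J \<noteq> {..<3}" using J(2) by auto
    then obtain i where i: "i < 3" "i \<notin> J" using J(1) by auto
    \<comment> \<open>Exactly one of the two coordinates other than \<open>i\<close> is set, so the
      majority of \<open>x b\<close> is \<open>b\<close>, which \<open>J\<close> cannot see.\<close>
    define x where "x b = (\<lambda>p\<in>{..<3}. if p = i then b else p = (if i = 0 then 1 else 0))" for b
    have "x b \<in> cube 3" for b by (auto simp: x_def cube_def)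
    moreover have "\<forall>j\<in>J. x False j = x True j"
    proof
      fix j assume "j \<in> J"
      then have "j \<noteq> i" using i by blast
      then show "x False j = x True j" by (simp add: x_def)
    qed
    ultimately have "f (x False) = f (x True)" using J(3) by simp
    moreover have "i = 0 \<or> i = 1 \<or> i = 2" using i(1) by linarith
    ultimately show False by (auto simp: f_def x_def)
  qed
  ultimately show ?thesis by blast
qed

section \<open>Greedy choice of almost independent terms\<close>

lemma exists_le_average:
  fixes h :: "'a \<Rightarrow> real" and c :: real
  assumes "finite B" "B \<noteq> {}" "sum h B \<le> c * card B"
  shows "\<exists>b\<in>B. h b \<le> c"
proof (rule ccontr)
  assume "\<not> ?thesis"
  then have "(\<Sum>b\<in>B. c) < sum h B" using assms by (intro sum_strict_mono) auto
  then show False using assms(3) by (simp add: mult.commute)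
qed

text \<open>Block \<open>j\<close> runs from \<open>j * w\<close> to \<open>j * w + w - 1\<close>,
  and \<open>T j\<close> is the offset chosen in it. A term is identified with its set of
  coordinates.\<close>

definition transversal :: "nat \<Rightarrow> (nat \<Rightarrow> nat) \<Rightarrow> nat set" where
  "transversal w T = (\<lambda>j. j * w + T j) ` {..<w}"

lemma block_index_eq_iff:
  fixes a b w :: nat
  assumes "a < w" "b < w"
  shows "j * w + a = j' * w + b \<longleftrightarrow> j = j' \<and> a = b"
proof -
  have "(j * w + a) div w = j" "(j' * w + b) div w = j'" using assms by simp_all
  then show ?thesis by auto
qed

lemma transversal_subset:
  assumes "T \<in> {..<w} \<rightarrow> {..<w}"
  shows "transversal w T \<subseteq> {..<w * w}"
proof -
  have "j * w + T j < w * w" if "j < w" for j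
  proof -
    have "j * w + T j < Suc j * w" using assms that by auto
    also have "\<dots> \<le> w * w" using that by (intro mult_le_mono1) simp
    finally show ?thesis .
  qed
  then show ?thesis by (auto simp: transversal_def)
qed

lemma card_transversal_Int:
  assumes "T \<in> {..<w} \<rightarrow> {..<w}" "T' \<in> {..<w} \<rightarrow> {..<w}"
  shows "card (transversal w T \<inter> transversal w T') = card {j \<in> {..<w}. T j = T' j}"
proof -
  have *: "T j < w" "T' j < w" if "j < w" for j using assms that by auto
  then have "transversal w T \<inter> transversal w T' = (\<lambda>j. j * w + T j) ` {j \<in> {..<w}. T j = T' j}"
    by (auto simp: transversal_def block_index_eq_iff image_iff)
  moreover have "inj_on (\<lambda>j. j * w + T j) {j \<in> {..<w}. T j = T' j}"
    using * by (auto simp: inj_on_def block_index_eq_iff)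
  ultimately show ?thesis by (simp only: card_image)
qed

text \<open>This is \<open>(1 + 1/w) ^ w \<le> exp 1 \<le> 3\<close>, cleared of denominators
  because \<open>w ^ w\<close> counts the choice functions.\<close>

lemma one_plus_inverse_power_le_3:
  assumes "w > 0"
  shows "real (w + 1) ^ w \<le> 3 * real w ^ w"
proof -
  have "(1 + 1 / real w) ^ w \<le> exp (1 / real w) ^ w"
    by (intro power_mono exp_ge_add_one_self) simp
  also have "\<dots> = exp 1" using assms by (simp flip: exp_of_nat_mult)
  also have "\<dots> \<le> 3" by (rule exp_le)
  finally have "(1 + 1 / real w) ^ w * real w ^ w \<le> 3 * real w ^ w"
    by (intro mult_right_mono) auto
  moreover have "(1 + 1 / real w) ^ w * real w ^ w = real (w + 1) ^ w"
    using assms by (simp flip: power_mult_distrib add: field_simps)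
  ultimately show ?thesis by simp
qed

text \<open>The summand is a product over the blocks, so sum and product can be exchanged. In each
  block one offset contributes 2 and the other \<open>w - 1\<close> contribute 1.\<close>

lemma sum_two_power_agreement:
  assumes T': "T' \<in> {..<w} \<rightarrow> {..<w}"
  shows "(\<Sum>T \<in> {..<w} \<rightarrow>\<^sub>E {..<w}. 2 ^ card {j \<in> {..<w}. T j = T' j}) = real (w + 1) ^ w"
proof -
  have "(\<Sum>T \<in> {..<w} \<rightarrow>\<^sub>E {..<w}. 2 ^ card {j \<in> {..<w}. T j = T' j})
      = (\<Sum>T \<in> {..<w} \<rightarrow>\<^sub>E {..<w}. \<Prod>j<w. if T j = T' j then 2 else 1 :: real)"
    by (intro sum.cong refl) (simp add: prod.If_cases Collect_conj_eq lessThan_def)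
  also have "\<dots> = (\<Prod>j<w. \<Sum>v<w. if v = T' j then 2 else 1)"
    by (simp add: prod_sum_PiE)
  also have "\<dots> = (\<Prod>j<w. real (w + 1))"
  proof (intro prod.cong refl)
    fix j assume "j \<in> {..<w}"
    then have j: "T' j \<in> {..<w}" using T' by auto
    have "(\<Sum>v<w. if v = T' j then 2 else 1 :: real) = (\<Sum>v<w. 1 + (if v = T' j then 1 else 0))"
      by (intro sum.cong) auto
    also have "\<dots> = real (w + 1)" using j by (simp add: sum.distrib)
    finally show "(\<Sum>v<w. if v = T' j then 2 else 1 :: real) = real (w + 1)" .
  qed
  finally show ?thesis by simp
qed

text \<open>Terms are added one by one; each new one is chosen so that its cost against the earlier
  ones is at most the average over all choice functions.\<close>

lemma exists_almost_independent_terms: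
  assumes "w > 0"
  shows "\<exists>A. (\<forall>i. A i \<subseteq> {..<w * w} \<and> card (A i) = w) \<and>
    (\<Sum>i<N. \<Sum>i'\<in>{..<N} - {i}. 2 ^ card (A i \<inter> A i')) \<le> 3 * real N ^ 2"
proof -
  have "\<exists>T. (\<forall>i. T i \<in> {..<w} \<rightarrow>\<^sub>E {..<w}) \<and>
    (\<Sum>i<N. \<Sum>i'\<in>{..<N} - {i}. 2 ^ card (transversal w (T i) \<inter> transversal w (T i')))
      \<le> 3 * real N ^ 2"
  proof (induction N)
    case 0
    \<comment> \<open>The sum is empty, but every \<open>T i\<close> must already be a choice
      function; \<open>w > 0\<close> makes the offset 0 legal.\<close>
    then show ?case using assms by (intro exI[of _ "\<lambda>_. \<lambda>j\<in>{..<w}. 0"]) (simp add: PiE_iff extensional_def)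
  next
    case (Suc N)
    then obtain T where T: "\<And>i. T i \<in> {..<w} \<rightarrow>\<^sub>E {..<w}"
      and le: "(\<Sum>i<N. \<Sum>i'\<in>{..<N} - {i}. 2 ^ card (transversal w (T i) \<inter> transversal w (T i')))
        \<le> 3 * real N ^ 2" by blast
    define h where "h U = (\<Sum>i<N. 2 ^ card (transversal w U \<inter> transversal w (T i)) :: real)" for U
    let ?P = "{..<w} \<rightarrow>\<^sub>E {..<w}"
    have T': "T i \<in> {..<w} \<rightarrow> {..<w}" for i using T[of i] by (simp add: PiE_iff Pi_iff)
    have "sum h ?P = (\<Sum>i<N. \<Sum>U\<in>?P. 2 ^ card (transversal w U \<inter> transversal w (T i)))"
      unfolding h_def by (rule sum.swap)
    also have "\<dots> = (\<Sum>i<N. \<Sum>U\<in>?P. 2 ^ card {j \<in> {..<w}. U j = T i j})"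
      using T' by (intro sum.cong refl) (simp add: card_transversal_Int PiE_iff Pi_iff)
    also have "\<dots> = N * real (w + 1) ^ w"
      by (simp only: sum_two_power_agreement[OF T'] sum_constant card_lessThan)
    also have "\<dots> \<le> N * (3 * real w ^ w)"
      by (intro mult_left_mono one_plus_inverse_power_le_3 assms) simp
    also have "\<dots> = 3 * real N * card ?P" by (simp add: card_PiE)
    finally have "\<exists>U\<in>?P. h U \<le> 3 * real N"
      using T by (intro exists_le_average) (auto simp: finite_PiE)
    then obtain U where U: "U \<in> ?P" "h U \<le> 3 * real N" by blast
    define T2 where "T2 = T(N := U)"
    let ?q = "\<lambda>i i'. 2 ^ card (transversal w (T2 i) \<inter> transversal w (T2 i')) :: real"
    have eN: "{..<Suc N} - {N} = {..<N}" by auto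
    have ei: "{..<Suc N} - {i} = insert N ({..<N} - {i})" if "i < N" for i using that by auto
    have "(\<Sum>i<Suc N. \<Sum>i'\<in>{..<Suc N} - {i}. ?q i i')
        = (\<Sum>i<N. ?q i N + (\<Sum>i'\<in>{..<N} - {i}. ?q i i')) + (\<Sum>i'<N. ?q N i')"
      by (simp add: eN ei)
    also have "\<dots> = h U + (\<Sum>i<N. \<Sum>i'\<in>{..<N} - {i}. 2 ^ card (transversal w (T i) \<inter> transversal w (T i')))
        + h U"
      by (simp add: sum.distrib h_def T2_def Int_commute)
    \<comment> \<open>Ordered pairs count the cost of \<open>U\<close> twice, and
      \<open>3 * N\<^sup>2 + 6 * N \<le> 3 * (N + 1)\<^sup>2\<close>.\<close>
    also have "\<dots> \<le> 3 * real (Suc N) ^ 2"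
      using U(2) le by (simp add: power2_eq_square algebra_simps)
    finally show ?case using T U(1) by (intro exI[of _ T2]) (auto simp: T2_def)
  qed
  then obtain T where T: "\<And>i. T i \<in> {..<w} \<rightarrow>\<^sub>E {..<w}" and
    le: "(\<Sum>i<N. \<Sum>i'\<in>{..<N} - {i}. 2 ^ card (transversal w (T i) \<inter> transversal w (T i')))
      \<le> 3 * real N ^ 2" by blast
  have T': "T i \<in> {..<w} \<rightarrow> {..<w}" for i using T[of i] by (simp add: PiE_iff Pi_iff)
  have "card (transversal w (T i)) = w" for i
    using card_transversal_Int[OF T' T', of i i] by simp
  then show ?thesis using le transversal_subset[OF T']
    by (intro exI[of _ "\<lambda>i. transversal w (T i)"]) blast
qed

section \<open>The function and its decision tree\<close>

definition satisfied :: "(nat \<Rightarrow> nat set) \<Rightarrow> nat \<Rightarrow> (nat \<Rightarrow> bool) \<Rightarrow> nat set" where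
  "satisfied A N x = {i. i < N \<and> (\<forall>j\<in>A i. x j)}"

text \<open>A monotone address function: a unique satisfied term \<open>i\<close> addresses its
  private coordinate \<open>m + i\<close>. The three cases are merged into one formula in which
  \<open>satisfied\<close> and \<open>x\<close> occur only positively.\<close>

definition term_address :: "(nat \<Rightarrow> nat set) \<Rightarrow> nat \<Rightarrow> nat \<Rightarrow> (nat \<Rightarrow> bool) \<Rightarrow> bool" where
  "term_address A m N x \<longleftrightarrow>
    (\<exists>i\<in>satisfied A N x. x (m + i) \<or> (\<exists>i'\<in>satisfied A N x. i' \<noteq> i))"

lemma satisfied_cong:
  assumes "\<And>i. A i \<subseteq> {..<m}" "\<And>j. j < m \<Longrightarrow> x j = y j"
  shows "satisfied A N x = satisfied A N y"
  using assms unfolding satisfied_def by (metis lessThan_iff subsetD)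

lemma mono_on_term_address: "mono_on X (term_address A m N)"
proof (intro mono_onI)
  fix x y :: "nat \<Rightarrow> bool" assume "x \<le> y"
  then have "satisfied A N x \<subseteq> satisfied A N y" and "\<And>i. x i \<Longrightarrow> y i"
    by (auto simp: satisfied_def le_fun_def)
  then show "term_address A m N x \<le> term_address A m N y"
    unfolding term_address_def le_bool_def by blast
qed

text \<open>The first \<open>m\<close> coordinates determine \<open>satisfied\<close>; after reading
  them, at most one private coordinate remains to be queried.\<close>

lemma dtree_computable_term_address:
  assumes A: "\<And>i. A i \<subseteq> {..<m}" and "m + 1 \<le> d"
  shows "dtree_computable (m + N) d (term_address A m N)"
proof -
  define G where "G z = (let S = satisfied A N z in
    if \<exists>i. S = {i} then Query (m + the_elem S) (Leaf False) (Leaf True) else Leaf (S \<noteq> {}))" for z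
  have "coords (G z) \<subseteq> {..<m + N}" "depth (G z) \<le> 1" for z
    by (auto simp: G_def Let_def satisfied_def)
  then obtain t where t: "coords t \<subseteq> {..<m + N}" "depth t \<le> m + 1"
    "\<And>x. eval_dtree t x = eval_dtree (G (\<lambda>i. i < m \<and> x i)) x"
    using exists_dtree_prefix[of m "m + N" G 1] by auto
  have "eval_dtree t x = term_address A m N x" for x
  proof -
    have S: "satisfied A N (\<lambda>i. i < m \<and> x i) = satisfied A N x"
      using A by (rule satisfied_cong) simp
    show ?thesis
      unfolding t(3) G_def S Let_def term_address_def by auto
  qed
  then show ?thesis using t(1,2) assms(2) unfolding dtree_computable_def by (meson le_trans)
qed

section \<open>Distance from juntas\<close>

text \<open>Union bound: a point that satisfies \<open>A i\<close>, but not as the only term,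
  satisfies all of \<open>A i \<union> A i'\<close> for some other \<open>i'\<close>, and this union
  has \<open>2 * w - card (A i \<inter> A i')\<close> elements.\<close>

lemma card_satisfied_eq_singleton_ge:
  assumes A: "\<And>i. A i \<subseteq> {..<n}" and w: "\<And>i. card (A i) = w" and i: "i < N"
  shows "2 ^ n / 2 ^ w - 2 ^ n / 4 ^ w * (\<Sum>i'\<in>{..<N} - {i}. 2 ^ card (A i \<inter> A i'))
    \<le> real (card {x \<in> cube n. satisfied A N x = {i}})"
proof -
  define P where "P B = {x \<in> cube n. \<forall>j\<in>B. x j}" for B
  let ?U = "{x \<in> cube n. satisfied A N x = {i}}"
  have fin: "finite (A i)" for i using A finite_subset by blast
  have "P (A i) \<subseteq> ?U \<union> (\<Union>i'\<in>{..<N} - {i}. P (A i \<union> A i'))"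
    using i by (auto simp: P_def satisfied_def)
  then have "card (P (A i)) \<le> card (?U \<union> (\<Union>i'\<in>{..<N} - {i}. P (A i \<union> A i')))"
    by (intro card_mono) (auto simp: P_def)
  also have "\<dots> \<le> card ?U + card (\<Union>i'\<in>{..<N} - {i}. P (A i \<union> A i'))"
    by (rule card_Un_le)
  also have "\<dots> \<le> card ?U + (\<Sum>i'\<in>{..<N} - {i}. card (P (A i \<union> A i')))"
    by (intro add_left_mono card_UN_le) simp
  finally have "real (card (P (A i))) \<le> card ?U + (\<Sum>i'\<in>{..<N} - {i}. real (card (P (A i \<union> A i'))))"
    by (simp flip: of_nat_sum of_nat_add)
  moreover have "real (card (P (A i))) = 2 ^ n / 2 ^ w"
    unfolding P_def by (simp add: card_cube_all_true[OF A] w)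
  moreover have "real (card (P (A i \<union> A i'))) = 2 ^ n / 4 ^ w * 2 ^ card (A i \<inter> A i')" for i'
  proof -
    have "card (A i \<union> A i') + card (A i \<inter> A i') = w + w"
      using card_Un_Int[OF fin fin, of i i'] w by simp
    then have pow: "(2::real) ^ card (A i \<union> A i') * 2 ^ card (A i \<inter> A i') = 4 ^ w"
      by (simp flip: power_add power_mult_distrib)
         (simp add: power_add flip: power_mult_distrib)
    have "real (card (P (A i \<union> A i'))) = 2 ^ n / 2 ^ card (A i \<union> A i')"
      unfolding P_def using A by (intro card_cube_all_true) auto
    then show ?thesis by (simp flip: pow)
  qed
  ultimately show ?thesis by (simp add: sum_distrib_left)
qed

text \<open>Flipping coordinate \<open>m + i\<close> keeps \<open>i\<close> the only satisfied term,
  changes the value of \<open>term_address\<close> and leaves \<open>g\<close> fixed. So of a point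
  and its flip at least one is an error of \<open>g\<close>.\<close>

lemma card_disagree_satisfied_eq_singleton:
  assumes A: "\<And>i. A i \<subseteq> {..<m}" and i: "i < N"
    and g: "\<And>x y. x \<in> cube (m + N) \<Longrightarrow> y \<in> cube (m + N) \<Longrightarrow> \<forall>j\<in>J. x j = y j \<Longrightarrow> g x = g y"
    and J: "m + i \<notin> J"
  shows "card {x \<in> cube (m + N). satisfied A N x = {i}}
    \<le> 2 * card {x \<in> cube (m + N). satisfied A N x = {i} \<and> term_address A m N x \<noteq> g x}"
    (is "card ?U \<le> 2 * card ?D")
proof -
  let ?flip = "\<lambda>x. x(m + i := \<not> x (m + i))"
  have "x \<in> ?D \<union> ?flip ` ?D" if x: "x \<in> ?U" for x
  proof (cases "term_address A m N x = g x")
    case False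
    then show ?thesis using x by simp
  next
    case True
    have S: "satisfied A N (?flip x) = {i}"
      using x satisfied_cong[OF A, where x = "?flip x" and y = x and N = N] by simp
    have c: "?flip x \<in> cube (m + N)" using x i by (intro fun_upd_in_cube) auto
    have "g (?flip x) = g x" using x c J by (intro g) auto
    moreover have "term_address A m N (?flip x) \<noteq> term_address A m N x"
      using x S by (simp add: term_address_def)
    ultimately have "?flip x \<in> ?D" using c S True by auto
    then have "?flip (?flip x) \<in> ?flip ` ?D" by (rule imageI)
    then show ?thesis by simp
  qed
  then have "card ?U \<le> card (?D \<union> ?flip ` ?D)" by (intro card_mono) auto
  also have "\<dots> \<le> card ?D + card (?flip ` ?D)" by (rule card_Un_le)
  also have "\<dots> \<le> 2 * card ?D" using card_image_le[of ?D ?flip] by simp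
  finally show ?thesis .
qed

lemma disagreement_term_address_ge:
  assumes A: "\<And>i. A i \<subseteq> {..<m}" and w: "\<And>i. card (A i) = w"
    and indep: "(\<Sum>i<N. \<Sum>i'\<in>{..<N} - {i}. 2 ^ card (A i \<inter> A i')) \<le> 3 * real N ^ 2"
    and g: "junta (m + N) k g"
  shows "((real N - real k) / 2 ^ w - 3 * real N ^ 2 / 4 ^ w) / 2
    \<le> disagreement (m + N) (term_address A m N) g"
proof -
  define n where "n = m + N"
  obtain J where J: "J \<subseteq> {..<n}" "card J \<le> k"
    "\<forall>x\<in>cube n. \<forall>y\<in>cube n. (\<forall>i\<in>J. x i = y i) \<longrightarrow> g x = g y"
    using g unfolding junta_def n_def by blast
  have finJ: "finite J" using J(1) finite_subset by blast
  define I where "I = {i \<in> {..<N}. m + i \<notin> J}"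
  have I: "I \<subseteq> {..<N}" "finite I" by (auto simp: I_def)
  have "N \<le> card I + k"
  proof -
    \<comment> \<open>Each coordinate in \<open>J\<close> excludes at most one term. Those below
      \<open>m\<close> are sent to 0 by truncated subtraction, which only enlarges the
      cover.\<close>
    have "{..<N} \<subseteq> I \<union> (\<lambda>j. j - m) ` J" by (force simp: I_def)
    then have "card {..<N} \<le> card (I \<union> (\<lambda>j. j - m) ` J)"
      using finJ I by (intro card_mono) auto
    also have "\<dots> \<le> card I + card ((\<lambda>j. j - m) ` J)" by (rule card_Un_le)
    also have "\<dots> \<le> card I + card J" using card_image_le[OF finJ] by simp
    finally show ?thesis using J(2) by simp
  qed
  then have cI: "real N - real k \<le> card I" by linarith
  define U where "U i = {x \<in> cube n. satisfied A N x = {i}}" for i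
  define D where "D i = {x \<in> cube n. satisfied A N x = {i} \<and> term_address A m N x \<noteq> g x}" for i
  have UD: "card (U i) \<le> 2 * card (D i)" if "i \<in> I" for i
    unfolding U_def D_def n_def
  proof (rule card_disagree_satisfied_eq_singleton[OF A])
    show "i < N" "m + i \<notin> J" using that by (simp_all add: I_def)
    show "g x = g y" if "x \<in> cube (m + N)" "y \<in> cube (m + N)" "\<forall>j\<in>J. x j = y j" for x y
      by (rule J(3)[unfolded n_def, THEN bspec, THEN bspec, THEN mp, OF that])
  qed
  define s where "s i = (\<Sum>i'\<in>{..<N} - {i}. 2 ^ card (A i \<inter> A i') :: real)" for i
  have An: "A i \<subseteq> {..<n}" for i using A[of i] by (auto simp: n_def)
  have s0: "s i \<ge> 0" for i unfolding s_def by (intro sum_nonneg) simp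
  \<comment> \<open>The overlap bound is known only for all \<open>N\<close> terms together;
    nonnegative summands let it pass to \<open>I\<close>.\<close>
  have "sum s I \<le> sum s {..<N}" using I s0 by (intro sum_mono2) auto
  also have "\<dots> \<le> 3 * real N ^ 2" using indep by (simp add: s_def)
  finally have s: "sum s I \<le> 3 * real N ^ 2" .
  have "2 ^ n * ((real N - real k) / 2 ^ w - 3 * real N ^ 2 / 4 ^ w)
      \<le> 2 ^ n * (card I / 2 ^ w - sum s I / 4 ^ w)"
    using cI s by (intro mult_left_mono diff_mono divide_right_mono) auto
  also have "\<dots> = (\<Sum>i\<in>I. 2 ^ n / 2 ^ w - 2 ^ n / 4 ^ w * s i)"
    by (simp add: sum_subtractf right_diff_distrib sum_distrib_left sum_divide_distrib mult.commute)
  also have "\<dots> \<le> (\<Sum>i\<in>I. real (card (U i)))"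
    unfolding U_def s_def using I
    by (intro sum_mono card_satisfied_eq_singleton_ge An w) auto
  also have "\<dots> \<le> (\<Sum>i\<in>I. real (2 * card (D i)))"
    by (intro sum_mono of_nat_mono UD)
  \<comment> \<open>The sets \<open>D i\<close> are disjoint, since \<open>satisfied A N x\<close>
    determines \<open>i\<close>.\<close>
  also have "\<dots> = 2 * real (card (\<Union>i\<in>I. D i))"
    using I(2) by (subst card_UN_disjoint) (auto simp: D_def sum_distrib_left)
  also have "\<dots> \<le> 2 * real (card {x \<in> cube n. term_address A m N x \<noteq> g x})"
    by (intro mult_left_mono of_nat_mono card_mono) (auto simp: D_def)
  finally show ?thesis
    unfolding disagreement_def card_cube n_def[symmetric] by (simp add: field_simps)
qed

section \<open>Choice of the parameters\<close>

theorem theorem1: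
  shows "\<exists>\<epsilon>::real. \<epsilon> > 0 \<and> (\<exists>c::real. c > 0 \<and>
    (\<forall>d::nat. d \<ge> 3 \<longrightarrow>
      (\<exists>(n::nat) (k::nat) (f :: (nat \<Rightarrow> bool) \<Rightarrow> bool).
         n > 0 \<and> real k \<ge> exp (c * sqrt (real d)) \<and>
         mono_on (cube n) f \<and> dtree_computable n d f \<and>
         (\<forall>g :: (nat \<Rightarrow> bool) \<Rightarrow> bool. junta n k g \<longrightarrow> disagreement n f g \<ge> \<epsilon>))))"
proof (rule exI[of _ "1 / 128"], intro conjI, simp, rule exI[of _ "ln 2 / 6"], intro conjI allI impI)
  show "ln 2 / 6 > (0::real)" by simp
next
  fix d :: nat assume d: "d \<ge> 3"
  have k_ge: "exp (ln 2 / 6 * sqrt (real d)) \<le> real (2 ^ e)" if "sqrt (real d) \<le> 6 * real e" for e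
  proof -
    have "ln 2 / 6 * sqrt (real d) \<le> real e * ln 2"
      using mult_left_mono[OF that, of "ln 2 / 6"] by simp
    then have "exp (ln 2 / 6 * sqrt (real d)) \<le> exp (real e * ln 2)" by simp
    also have "\<dots> = 2 ^ e" by (simp add: exp_of_nat_mult)
    finally show ?thesis by simp
  qed
  show "\<exists>(n::nat) (k::nat) (f :: (nat \<Rightarrow> bool) \<Rightarrow> bool).
         n > 0 \<and> real k \<ge> exp (ln 2 / 6 * sqrt (real d)) \<and>
         mono_on (cube n) f \<and> dtree_computable n d f \<and>
         (\<forall>g :: (nat \<Rightarrow> bool) \<Rightarrow> bool. junta n k g \<longrightarrow> disagreement n f g \<ge> 1 / 128)"
  proof (cases "d \<le> 25")
    case True
    obtain f where f: "mono_on (cube 3) f" "dtree_computable 3 3 f" "\<not> junta 3 2 f"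
      using exists_mono_depth_3_not_2_junta by blast
    have "sqrt (real d) \<le> sqrt (6\<^sup>2)" using True by (intro real_sqrt_le_mono) simp
    then have "exp (ln 2 / 6 * sqrt (real d)) \<le> real 2" using k_ge[of 1] by simp
    moreover have "dtree_computable 3 d f"
      using f(2) d unfolding dtree_computable_def by (meson le_trans)
    \<comment> \<open>As \<open>f\<close> is not a 2-junta, the disagreement is at least
      \<open>1 / 2 ^ 3\<close>.\<close>
    moreover have "disagreement 3 f g \<ge> 1 / 128" if "junta 3 2 g" for g
      using junta_if_disagreement_less[OF that, of f] f(3) by (force simp: not_less)
    ultimately show ?thesis using f(1) by (intro exI[of _ 3] exI[of _ 2] exI[of _ f]) auto
  next
    case False
    \<comment> \<open>Subtracting 1 from \<open>d\<close> leaves room for the final query of a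
      private coordinate.\<close>
    define w where "w = floor_sqrt (d - 1)"
    have wd: "w * w + 1 \<le> d"
      using floor_sqrt_power2_le[of "d - 1"] False by (simp add: w_def power2_eq_square)
    have dw: "d \<le> (w + 1)\<^sup>2"
      using Suc_floor_sqrt_power2_gt[of "d - 1"] by (simp add: w_def)
    have w5: "w \<ge> 5"
      unfolding w_def using False by (intro le_floor_sqrtI) simp
    define N :: nat where "N = 2 ^ (w - 3)"
    define k :: nat where "k = 2 ^ (w - 4)"
    obtain A where A: "\<And>i. A i \<subseteq> {..<w * w}" "\<And>i. card (A i) = w"
      "(\<Sum>i<N. \<Sum>i'\<in>{..<N} - {i}. 2 ^ card (A i \<inter> A i')) \<le> 3 * real N ^ 2"
      using exists_almost_independent_terms[of w N] w5 by auto
    have "sqrt (real d) \<le> sqrt ((real w + 1)\<^sup>2)"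
      using dw by (intro real_sqrt_le_mono) (metis of_nat_1 of_nat_add of_nat_le_iff of_nat_power)
    \<comment> \<open>The 6 in \<open>ln 2 / 6\<close> comes from here:
      \<open>w + 1 \<le> 6 * (w - 4)\<close> holds from \<open>w = 5\<close> on, with equality
      there.\<close>
    also have "\<dots> \<le> 6 * real (w - 4)" using w5 by (simp add: of_nat_diff)
    finally have k: "exp (ln 2 / 6 * sqrt (real d)) \<le> real k" unfolding k_def by (rule k_ge)
    have far: "1 / 128 \<le> disagreement (w * w + N) (term_address A (w * w) N) g"
      if "junta (w * w + N) k g" for g
    proof -
      have N: "real N = 2 ^ w / 8" and k: "real k = 2 ^ w / 16"
        using w5 power_diff[of "2::real" 3 w] power_diff[of "2::real" 4 w]
        by (simp_all only: N_def k_def of_nat_power of_nat_numeral) simp_all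
      have "(4::real) ^ w = 2 ^ w * 2 ^ w" by (simp flip: power_mult_distrib)
      \<comment> \<open>The value is \<open>(1/8 - 1/16 - 3/64) / 2\<close>.\<close>
      then have "((real N - real k) / 2 ^ w - 3 * real N ^ 2 / 4 ^ w) / 2 = 1 / 128"
        by (simp add: N k power2_eq_square field_simps)
      then show ?thesis using disagreement_term_address_ge[OF A that] by (simp only:)
    qed
    have "w * w + N > 0" by (simp add: N_def)
    then show ?thesis
      by (intro exI conjI allI impI)
        (assumption, rule k, rule mono_on_term_address,
          rule dtree_computable_term_address[OF A(1) wd], rule far)
  qed
qed

end
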